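(* Let $x=x(t,w)$, $0<w<1$, be the family of optimal curves of the multi-objective problem (MOP) with respect to some scalarization with weight parameter $w$, and let $F_1(w),F_2(w)$ be the corresponding objective values. Suppose that the Pareto front $PF$ of (MOP) with respect to the weight $w$ can be written as $F_2(w)=PF(F_1(w))$, and that $F_1$, $F_2$ and $PF$ are all twice-differentiable. Then $PF$ is convex if and only if $$F_1'(w)\bigl(F_1'(w)F_2''(w)-F_1''(w)F_2'(w)\bigr)\geq 0\quad\text{for all } w\in(0,1),$$ where primes on $F_1,F_2$ denote derivatives with respect to $w$.
   Context: Let $M$ be a path-connected Riemannian manifold with metric $\langle\cdot,\cdot\rangle$ and Levi-Civita connection $\nabla$; $\nabla_t$ denotes covariant differentiation along a curve with respect to $t$, and a dot denotes $d/dt$. Fix $t_0<t_f$, points $x_0,x_1\in M$ and velocities $v_0\in T_{x_0}M$, $v_1\in T_{x_1}M$. Let $\mathcal{X}$ be the space of all smooth curves $x:[t_0,t_f]\to M$ with $x(t_0)=x_0$, $\dot x(t_0)=v_0$, $x(t_f)=x_1$, $\dot x(t_f)=v_1$. For $x\in\mathcal{X}$ put $$F_1(x)=\int_{t_0}^{t_f}\langle\dot x,\dot x\rangle\,dt,\qquad F_2(x)=\int_{t_0}^{t_f}\langle\nabla_t\dot x,\nabla_t\dot x\rangle\,dt .$$ The problem (MOP) is to minimize the vector $(F_1(x),F_2(x))$ over $x\in\mathcal{X}$. A scalarization replaces (MOP) by a family of single-objective problems over $\mathcal{X}$ depending on a weight $w$, for example the weighted-sum scalarization $\min_{x\in\mathcal{X}}\,(wF_1(x)+(1-w)F_2(x))$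 or the Chebychev scalarization $\min_{x\in\mathcal{X}}\max\{wF_1(x),(1-w)F_2(x)\}$. For a chosen scalarization, $x(\cdot,w)\in\mathcal{X}$ denotes an optimal curve for weight $w\in(0,1)$, and $F_i(w):=F_i(x(\cdot,w))$ for $i=1,2$. The Pareto front with respect to the scalarization is the set of points $(F_1(w),F_2(w))$, $w\in(0,1)$, in the objective value plane; when it is the graph of a function, this function is also denoted $PF$, defined on the set of values of $F_1(w)$. Convexity: $PF$ is called convex if $PF(sF_1+(1-s)\tilde F_1)\le s\,PF(F_1)+(1-s)\,PF(\tilde F_1)$ for all values $F_1,\tilde F_1$ on the front (i.e. in the domain of $PF$) and all $s\in[0,1]$ such that $sF_1+(1-s)\tilde F_1$ is also on the front. *)

theory Defs
  imports "HOL-Analysis.Analysis"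
begin

section \<open>Smooth maps\<close>

text \<open>The predicate is meant for open sets \<open>S\<close> and finite-dimensional domains only, where
  continuity of all iterated directional derivatives is the usual notion of \<open>C\<^sup>k\<close>.\<close>

primrec Ck_on :: "nat \<Rightarrow> ('a::real_normed_vector \<Rightarrow> 'b::real_normed_vector) \<Rightarrow> 'a set \<Rightarrow> bool" where
  "Ck_on 0 f S \<longleftrightarrow> continuous_on S f"
| "Ck_on (Suc k) f S \<longleftrightarrow>
     (\<forall>y\<in>S. f differentiable (at y)) \<and>
     (\<forall>v. Ck_on k (\<lambda>y. frechet_derivative f (at y) v) S)"

definition smooth_on :: "('a::real_normed_vector \<Rightarrow> 'b::real_normed_vector) \<Rightarrow> 'a set \<Rightarrow> bool" where
  "smooth_on f S \<longleftrightarrow> (\<forall>k. Ck_on k f S)"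

section \<open>Smooth manifolds\<close>

text \<open>The manifold is the whole type \<open>'m\<close>. The values of a chart map outside its domain are irrelevant.\<close>

datatype ('m, 'e) chart = Chart (chart_dom: "'m set") (chart_map: "'m \<Rightarrow> 'e")

definition chart_inv :: "('m, 'e) chart \<Rightarrow> 'e \<Rightarrow> 'm" where
  "chart_inv c = inv_into (chart_dom c) (chart_map c)"

definition chart_img :: "('m, 'e) chart \<Rightarrow> 'e set" where
  "chart_img c = chart_map c ` chart_dom c"

definition transition :: "('m, 'e) chart \<Rightarrow> ('m, 'e) chart \<Rightarrow> 'e \<Rightarrow> 'e" where
  "transition c c' = chart_map c' \<circ> chart_inv c"

text \<open>The model space \<open>'e\<close> is a finite-dimensional normed space; the class \<open>euclidean_space\<close> would
  exclude manifolds of dimension 0.\<close>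

locale smooth_manifold =
  fixes A :: "('m::{t2_space, second_countable_topology}, 'e::real_normed_vector) chart set"
  assumes finite_dimensional: "\<exists>B::'e set. finite B \<and> span B = UNIV"
    and chart_covers: "(\<Union>c\<in>A. chart_dom c) = UNIV"
    and chart_dom_open: "c \<in> A \<Longrightarrow> open (chart_dom c)"
    and chart_img_open: "c \<in> A \<Longrightarrow> open (chart_img c)"
    and chart_homeomorphism:
      "c \<in> A \<Longrightarrow> homeomorphism (chart_dom c) (chart_img c) (chart_map c) (chart_inv c)"
    and transition_smooth: "c \<in> A \<Longrightarrow> c' \<in> A \<Longrightarrow>
      smooth_on (transition c c') (chart_map c ` (chart_dom c \<inter> chart_dom c'))"

section \<open>Tangent vectors\<close>

text \<open>A tangent vector at \<open>p\<close> is the family of its representatives in all charts around \<open>p\<close>,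
  related by the differentials of the transition maps. The value 0 at the other charts is a
  convention which makes equality of tangent vectors equality of functions.\<close>

type_synonym ('m, 'e) tangent = "('m, 'e) chart \<Rightarrow> 'e"

definition tangent_space ::
    "('m, 'e::real_normed_vector) chart set \<Rightarrow> 'm \<Rightarrow> ('m, 'e) tangent set" where
  "tangent_space A p = {u.
     (\<forall>c. \<not> (c \<in> A \<and> p \<in> chart_dom c) \<longrightarrow> u c = 0) \<and>
     (\<forall>c\<in>A. \<forall>c'\<in>A. p \<in> chart_dom c \<inter> chart_dom c' \<longrightarrow>
        u c' = frechet_derivative (transition c c') (at (chart_map c p)) (u c))}"

text \<open>The tangent vector at \<open>p\<close> with representative \<open>a\<close> in the chart \<open>c\<close>.\<close>

definition tangent_of ::
    "('m, 'e::real_normed_vector) chart set \<Rightarrow> ('m, 'e) chart \<Rightarrow> 'm \<Rightarrow> 'e \<Rightarrow> ('m, 'e) tangent" where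
  "tangent_of A c p a = (\<lambda>c'. if c' \<in> A \<and> p \<in> chart_dom c'
     then frechet_derivative (transition c c') (at (chart_map c p)) a else 0)"

section \<open>Riemannian metrics and the Levi-Civita connection\<close>

type_synonym ('m, 'e) metric = "'m \<Rightarrow> ('m, 'e) tangent \<Rightarrow> ('m, 'e) tangent \<Rightarrow> real"

definition local_metric ::
    "('m, 'e::real_normed_vector) chart set \<Rightarrow> ('m, 'e) metric \<Rightarrow> ('m, 'e) chart \<Rightarrow> 'e \<Rightarrow> 'e \<Rightarrow> 'e \<Rightarrow> real"
  where
  "local_metric A g c y a b =
     g (chart_inv c y) (tangent_of A c (chart_inv c y) a) (tangent_of A c (chart_inv c y) b)"

locale riemannian_manifold = smooth_manifold A
  for A :: "('m::{t2_space, second_countable_topology}, 'e::real_normed_vector) chart set" +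
  fixes g :: "('m, 'e) metric"
  assumes metric_sym: "u \<in> tangent_space A p \<Longrightarrow> v \<in> tangent_space A p \<Longrightarrow> g p u v = g p v u"
    and metric_linear: "u \<in> tangent_space A p \<Longrightarrow> v \<in> tangent_space A p \<Longrightarrow> w \<in> tangent_space A p \<Longrightarrow>
      g p (\<lambda>c. r *\<^sub>R u c + s *\<^sub>R v c) w = r * g p u w + s * g p v w"
    and metric_pos: "u \<in> tangent_space A p \<Longrightarrow> u \<noteq> (\<lambda>_. 0) \<Longrightarrow> g p u u > 0"
    and metric_smooth: "c \<in> A \<Longrightarrow> smooth_on (\<lambda>y. local_metric A g c y a b) (chart_img c)"

text \<open>An affine connection is given by its coefficients in the charts: for a vector field with
  representative \<open>Y\<close> in the chart \<open>c\<close>, the covariant derivative at the point with coordinates \<open>y\<close>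
  in direction \<open>a\<close> is \<open>DY(y) a + \<Gamma> c y a (Y y)\<close>. The last condition says that this vector
  does not depend on the chart.\<close>

type_synonym ('m, 'e) connection = "('m, 'e) chart \<Rightarrow> 'e \<Rightarrow> 'e \<Rightarrow> 'e \<Rightarrow> 'e"

definition affine_connection ::
    "('m, 'e::real_normed_vector) chart set \<Rightarrow> ('m, 'e) connection \<Rightarrow> bool" where
  "affine_connection A \<Gamma> \<longleftrightarrow>
     (\<forall>c\<in>A. \<forall>y\<in>chart_img c. bilinear (\<Gamma> c y)) \<and>
     (\<forall>c\<in>A. \<forall>a b. smooth_on (\<lambda>y. \<Gamma> c y a b) (chart_img c)) \<and>
     (\<forall>c\<in>A. \<forall>c'\<in>A. \<forall>y\<in>chart_map c ` (chart_dom c \<inter> chart_dom c'). \<forall>a b.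
        let \<tau> = transition c c'; D = (\<lambda>z. frechet_derivative \<tau> (at z)) in
        \<Gamma> c' (\<tau> y) (D y a) (D y b) =
          D y (\<Gamma> c y a b) - frechet_derivative (\<lambda>z. D z b) (at y) a)"

definition torsion_free ::
    "('m, 'e::real_normed_vector) chart set \<Rightarrow> ('m, 'e) connection \<Rightarrow> bool" where
  "torsion_free A \<Gamma> \<longleftrightarrow> (\<forall>c\<in>A. \<forall>y\<in>chart_img c. \<forall>a b. \<Gamma> c y a b = \<Gamma> c y b a)"

definition metric_compatible ::
    "('m, 'e::real_normed_vector) chart set \<Rightarrow> ('m, 'e) metric \<Rightarrow> ('m, 'e) connection \<Rightarrow> bool" where
  "metric_compatible A g \<Gamma> \<longleftrightarrow> (\<forall>c\<in>A. \<forall>y\<in>chart_img c. \<forall>a b d.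
     frechet_derivative (\<lambda>z. local_metric A g c z b d) (at y) a =
       local_metric A g c y (\<Gamma> c y a b) d + local_metric A g c y b (\<Gamma> c y a d))"

definition levi_civita ::
    "('m, 'e::real_normed_vector) chart set \<Rightarrow> ('m, 'e) metric \<Rightarrow> ('m, 'e) connection \<Rightarrow> bool" where
  "levi_civita A g \<Gamma> \<longleftrightarrow>
     affine_connection A \<Gamma> \<and> torsion_free A \<Gamma> \<and> metric_compatible A g \<Gamma>"

section \<open>Curves\<close>

text \<open>Curves are functions on all of \<open>real\<close> of which only the restriction to \<open>{t0..tf}\<close> matters;
  all derivatives are taken within \<open>{t0..tf}\<close> and are one-sided at the end points. In
  \<open>smooth_curve\<close>, \<open>d k\<close> is the \<open>k\<close>-th derivative of the curve in the chart \<open>c\<close>.\<close>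

definition smooth_curve ::
    "('m::topological_space, 'e::real_normed_vector) chart set \<Rightarrow> real \<Rightarrow> real \<Rightarrow> (real \<Rightarrow> 'm) \<Rightarrow> bool" where
  "smooth_curve A t0 tf x \<longleftrightarrow> continuous_on {t0..tf} x \<and>
     (\<forall>c\<in>A. let T = {t \<in> {t0..tf}. x t \<in> chart_dom c} in
        \<exists>d :: nat \<Rightarrow> real \<Rightarrow> 'e. \<forall>t\<in>T. d 0 t = chart_map c (x t) \<and>
          (\<forall>k. (d k has_vector_derivative d (Suc k) t) (at t within T)))"

definition velocity ::
    "('m, 'e::real_normed_vector) chart set \<Rightarrow> real \<Rightarrow> real \<Rightarrow> (real \<Rightarrow> 'm) \<Rightarrow> real \<Rightarrow> ('m, 'e) tangent" where
  "velocity A t0 tf x t = (\<lambda>c. if c \<in> A \<and> x t \<in> chart_dom c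
     then vector_derivative (\<lambda>s. chart_map c (x s)) (at t within {t0..tf}) else 0)"

definition covariant_derivative ::
    "('m, 'e::real_normed_vector) chart set \<Rightarrow> ('m, 'e) connection \<Rightarrow> real \<Rightarrow> real \<Rightarrow>
      (real \<Rightarrow> 'm) \<Rightarrow> (real \<Rightarrow> ('m, 'e) tangent) \<Rightarrow> real \<Rightarrow> ('m, 'e) tangent" where
  "covariant_derivative A \<Gamma> t0 tf x V t = (\<lambda>c. if c \<in> A \<and> x t \<in> chart_dom c
     then vector_derivative (\<lambda>s. V s c) (at t within {t0..tf})
        + \<Gamma> c (chart_map c (x t)) (velocity A t0 tf x t c) (V t c)
     else 0)"

section \<open>The multi-objective problem\<close>

definition admissible_curves ::
    "('m::topological_space, 'e::real_normed_vector) chart set \<Rightarrow> real \<Rightarrow> real \<Rightarrow>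
      'm \<Rightarrow> ('m, 'e) tangent \<Rightarrow> 'm \<Rightarrow> ('m, 'e) tangent \<Rightarrow> (real \<Rightarrow> 'm) set" where
  "admissible_curves A t0 tf x0 v0 x1 v1 = {x. smooth_curve A t0 tf x \<and>
     x t0 = x0 \<and> velocity A t0 tf x t0 = v0 \<and> x tf = x1 \<and> velocity A t0 tf x tf = v1}"

definition objective1 ::
    "('m, 'e::real_normed_vector) chart set \<Rightarrow> ('m, 'e) metric \<Rightarrow> real \<Rightarrow> real \<Rightarrow> (real \<Rightarrow> 'm) \<Rightarrow> real" where
  "objective1 A g t0 tf x =
     integral {t0..tf} (\<lambda>t. g (x t) (velocity A t0 tf x t) (velocity A t0 tf x t))"

definition objective2 ::
    "('m, 'e::real_normed_vector) chart set \<Rightarrow> ('m, 'e) metric \<Rightarrow> ('m, 'e) connection \<Rightarrow>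
      real \<Rightarrow> real \<Rightarrow> (real \<Rightarrow> 'm) \<Rightarrow> real" where
  "objective2 A g \<Gamma> t0 tf x =
     (let acc = covariant_derivative A \<Gamma> t0 tf x (velocity A t0 tf x)
      in integral {t0..tf} (\<lambda>t. g (x t) (acc t) (acc t)))"

text \<open>A scalarization maps a weight and the two objective values to a single objective value, for
  instance \<open>\<lambda>w a b. w * a + (1 - w) * b\<close> (weighted sum) or
  \<open>\<lambda>w a b. max (w * a) ((1 - w) * b)\<close> (Chebychev).\<close>

type_synonym scalarization = "real \<Rightarrow> real \<Rightarrow> real \<Rightarrow> real"

definition pareto_front :: "(real \<Rightarrow> real) \<Rightarrow> (real \<Rightarrow> real) \<Rightarrow> (real \<times> real) set" where
  "pareto_front F1 F2 = {(F1 w, F2 w) | w. w \<in> {0<..<1}}"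

definition convex_front :: "real set \<Rightarrow> (real \<Rightarrow> real) \<Rightarrow> bool" where
  "convex_front D PF \<longleftrightarrow> (\<forall>a\<in>D. \<forall>b\<in>D. \<forall>s\<in>{0..1}. s * a + (1 - s) * b \<in> D \<longrightarrow>
     PF (s * a + (1 - s) * b) \<le> s * PF a + (1 - s) * PF b)"

text \<open>Derivatives are relative to \<open>S\<close>, hence ordinary ones at interior points and one-sided
  ones at the end points of an interval. If \<open>S\<close> is a single point the condition is void.\<close>

definition twice_differentiable_on :: "(real \<Rightarrow> real) \<Rightarrow> real set \<Rightarrow> bool" where
  "twice_differentiable_on f S \<longleftrightarrow> (\<exists>f' f''. \<forall>y\<in>S.
     (f has_real_derivative f' y) (at y within S) \<and>
     (f' has_real_derivative f'' y) (at y within S))"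

end

theory Submission
  imports Defs
begin

text \<open>The chain rule gives \<open>F\<^sub>1' (F\<^sub>1' F\<^sub>2'' - F\<^sub>1'' F\<^sub>2') = PF''(F\<^sub>1) F\<^sub>1'\<^sup>4\<close>, so the condition
  says that \<open>PF''\<close> is nonnegative at all regular values of \<open>F\<^sub>1\<close>. At critical values nothing is known
  about \<open>PF''\<close>, but by Sard's theorem they form a null set, and a function that is
  differentiable everywhere and has a nonnegative derivative almost everywhere is nondecreasing.
  Hence \<open>PF'\<close> is nondecreasing, which is convexity of \<open>PF\<close> on the interval of values of \<open>F\<^sub>1\<close>.\<close>

section \<open>Null sets of critical values, and monotonicity\<close>

text \<open>The one-dimensional Sard theorem, transported from \<open>real^1\<close>. The derivative
  is required only along \<open>C\<close>, where it is zero and so has rank 0 < 1.\<close>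

lemma negligible_critical_values:
  fixes f :: "real \<Rightarrow> real"
  assumes "\<And>x. x \<in> C \<Longrightarrow> (f has_real_derivative 0) (at x within C)"
  shows "negligible (f ` C)"
proof -
  let ?lift = "vec :: real \<Rightarrow> real^1"
  let ?drop = "\<lambda>x::real^1. x $ 1"
  have der: "(?lift \<circ> f \<circ> ?drop has_derivative (\<lambda>_. 0)) (at x within ?lift ` C)" if "x \<in> ?lift ` C" for x
  proof -
    obtain z where z: "z \<in> C" "x = ?lift z"
      using \<open>x \<in> ?lift ` C\<close> by auto
    have "((\<lambda>x. ?lift (f (?drop x))) has_derivative (*\<^sub>R) 0) (at (?lift z) within ?lift ` C)"
      using assms[OF z(1)]
      by (intro has_derivative_vector_1) (simp only: has_field_derivative_def mult_commute_abs)
    moreover have "(*\<^sub>R) 0 = (\<lambda>_. 0 :: real^1)"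
      by auto
    ultimately show ?thesis
      using z by (simp add: o_def)
  qed
  have "rank (matrix (\<lambda>_::real^1. 0::real^1)) = 0"
    by (simp add: matrix_def zero_vec_def[symmetric])
  then have "negligible ((?lift \<circ> f \<circ> ?drop) ` (?lift ` C))"
    by (intro baby_Sard[where f' = "\<lambda>_ _. 0"] der) auto
  \<comment> \<open>Differentiable maps between spaces of equal dimension preserve null sets, which
    brings the result back to \<open>real\<close>.\<close>
  moreover have "?drop differentiable_on U" for U
    by (simp add: linear_imp_differentiable_on bounded_linear.linear bounded_linear_vec_nth)
  ultimately have "negligible (?drop ` ((?lift \<circ> f \<circ> ?drop) ` (?lift ` C)))"
    using negligible_differentiable_image_negligible[where f = ?drop] by simp
  then show ?thesis
    by (simp add: image_comp o_def)
qed

text \<open>Integrating \<open>h'\<close> is no option, since it may fail to be integrable. Instead,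
  a strict drop of \<open>h\<close> survives a small upward tilt that makes the derivative positive
  off \<open>N\<close>. Some level crossed by the tilted function avoids the null image of
  \<open>N\<close>, and its last crossing would have to go downwards with a positive
  derivative.\<close>

lemma le_if_deriv_nonneg_ae:
  fixes h :: "real \<Rightarrow> real"
  assumes "a \<le> b" "negligible N"
    and der: "\<And>x. x \<in> {a..b} \<Longrightarrow> (h has_real_derivative h' x) (at x within {a..b})"
    and nonneg: "\<And>x. x \<in> {a..b} - N \<Longrightarrow> 0 \<le> h' x"
  shows "h a \<le> h b"
proof (rule ccontr)
  assume "\<not> h a \<le> h b"
  then have lt: "h b < h a" by simp
  then have "a < b"
    using \<open>a \<le> b\<close> by (cases "a = b") auto
  \<comment> \<open>Half the mean rate of descent: the tilted \<open>k\<close> still drops by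
    \<open>(h a - h b) / 2\<close>.\<close>
  define e where "e = (h a - h b) / (2 * (b - a))"
  define k where "k = (\<lambda>x. h x + e * (x - a))"
  have "e > 0"
    using lt \<open>a < b\<close> by (simp add: e_def)
  have kder: "(k has_real_derivative h' x + e) (at x within {a..b})" if "x \<in> {a..b}" for x
    unfolding k_def using der[OF that] by (auto intro!: derivative_eq_intros)
  then have cont: "continuous_on {a..b} k"
    by (meson DERIV_continuous continuous_on_eq_continuous_within)
  have "e * (b - a) = (h a - h b) / 2"
    using \<open>a < b\<close> by (simp add: e_def field_simps)
  then have "k b < k a"
    using lt by (simp add: k_def)
  have "k differentiable_on N \<inter> {a..b}"
    unfolding differentiable_on_def
    by (meson IntD2 Int_lower2 field_differentiable_imp_differentiable field_differentiable_def
        differentiable_within_subset kder)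
  then have "negligible (k ` (N \<inter> {a..b}))"
    using \<open>negligible N\<close>
    by (intro negligible_differentiable_image_negligible) (auto intro: negligible_subset)
  moreover have "\<not> negligible {k b<..<k a}"
    using \<open>k b < k a\<close> open_not_negligible[of "{k b<..<k a}"] by auto
  ultimately obtain y where y: "k b < y" "y < k a" "y \<notin> k ` (N \<inter> {a..b})"
    by (metis greaterThanLessThan_iff negligible_subset subsetI)
  \<comment> \<open>The maximum of \<open>T\<close> is the last point where \<open>k\<close> is at
    least \<open>y\<close>.\<close>
  define T where "T = {t \<in> {a..b}. y \<le> k t}"
  have "closed T"
    unfolding T_def by (intro continuous_on_closed_Collect_le cont continuous_on_const closed_atLeastAtMost)
  then have "compact T"
    by (auto simp: T_def compact_eq_bounded_closed intro: bounded_subset[of "{a..b}"])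
  moreover have "a \<in> T"
    using y \<open>a < b\<close> by (simp add: T_def)
  ultimately obtain t where t: "t \<in> T" "\<And>s. s \<in> T \<Longrightarrow> s \<le> t"
    using compact_attains_sup[of T] by auto
  have t': "a \<le> t" "t \<le> b" "y \<le> k t"
    using t by (auto simp: T_def)
  then have "t < b"
    using y(1) by (cases "t = b") auto
  obtain s where s: "t \<le> s" "s \<le> b" "k s = y"
    using IVT2'[of k b y t] y t' continuous_on_subset[OF cont, of "{t..b}"] by auto
  then have "s = t"
    using t(2)[of s] t' by (auto simp: T_def)
  then have "k t = y"
    using s by simp
  then have "t \<notin> N"
    using y t' by auto
  then have "h' t + e > 0"
    using nonneg[of t] t' \<open>e > 0\<close> by auto
  \<comment> \<open>The function \<open>k\<close> rises strictly just to the right of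
    \<open>t\<close>, which produces points of \<open>T\<close> beyond its maximum.\<close>
  then obtain d where d: "d > 0" "\<And>u. u > 0 \<Longrightarrow> t + u \<in> {a..b} \<Longrightarrow> u < d \<Longrightarrow> k t < k (t + u)"
    using has_real_derivative_pos_inc_right[OF kder[of t]] t' by auto
  define u where "u = min (d / 2) (b - t)"
  have "u > 0" "u < d" "t + u \<in> {a..b}"
    using d(1) \<open>t < b\<close> t' by (auto simp: u_def min_def)
  then have "t + u \<in> T"
    using d(2)[of u] \<open>k t = y\<close> by (auto simp: T_def)
  then show False
    using t(2) \<open>u > 0\<close> by force
qed

section \<open>Convexity and derivatives on an interval\<close>

text \<open>The height of the chord above the graph is nonnegative along the segment from
  \<open>a\<close> to \<open>b\<close> and vanishes at \<open>a\<close>. Its one-sided derivative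
  there is therefore nonnegative.\<close>

lemma convex_front_tangent:
  assumes "convex_front D f" "is_interval D" "a \<in> D" "b \<in> D"
    and der: "(f has_real_derivative l) (at a within D)"
  shows "l * (b - a) \<le> f b - f a"
proof -
  \<comment> \<open>Parametrizing the segment over \<open>{0..1}\<close> turns both orders of
    \<open>a\<close> and \<open>b\<close> into a right derivative at 0; \<open>q\<close> is chord
    minus graph.\<close>
  define p where "p = (\<lambda>s. a + s * (b - a))"
  define q where "q = (\<lambda>s. f a + s * (f b - f a) - f (p s))"
  have p_eq: "p s = s * b + (1 - s) * a" for s
    by (simp add: p_def algebra_simps)
  have pD: "p s \<in> D" if "s \<in> {0..1}" for s
    using convexD[of D b a s "1 - s"] that assms(2-4)
    by (simp add: p_eq is_interval_convex_1)
  have "(f has_real_derivative l) (at (p 0) within p ` {0..1})"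
    using der pD by (auto simp: p_def intro: DERIV_subset)
  moreover have "(p has_real_derivative b - a) (at 0 within {0..1})"
    unfolding p_def by (auto intro!: derivative_eq_intros)
  ultimately have "(f \<circ> p has_real_derivative l * (b - a)) (at 0 within {0..1})"
    by (rule DERIV_image_chain)
  then have qder: "(q has_real_derivative f b - f a - l * (b - a)) (at 0 within {0..1})"
    unfolding q_def o_def by (auto intro!: derivative_eq_intros)
  have q_nonneg: "q s \<ge> 0" if s: "s \<in> {0..1}" for s
  proof -
    have "f (s * b + (1 - s) * a) \<le> s * f b + (1 - s) * f a"
      using assms s pD[OF s] by (auto simp: convex_front_def p_eq)
    then show ?thesis
      by (simp add: q_def p_eq algebra_simps)
  qed
  show ?thesis
  proof (rule ccontr)
    assume "\<not> ?thesis"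
    then obtain d where d: "d > 0" "\<And>h. h > 0 \<Longrightarrow> 0 + h \<in> {0..1} \<Longrightarrow> h < d \<Longrightarrow> q (0 + h) < q 0"
      using has_real_derivative_neg_dec_right[OF qder] by auto
    have "q (min (d / 2) 1) < q 0"
      using d(2)[of "min (d / 2) 1"] d(1) by (auto simp: min_def)
    moreover have "q 0 = 0"
      by (simp add: q_def p_def)
    ultimately show False
      using q_nonneg[of "min (d / 2) 1"] d(1) by (auto simp: min_def split: if_splits)
  qed
qed

text \<open>Adding the tangent inequalities at two points shows that \<open>f'\<close> is
  nondecreasing, which a negative \<open>l\<close> would contradict near \<open>a\<close>. The
  second point \<open>b\<close> excludes a singleton \<open>D\<close>, on which every number is a
  derivative.\<close>

lemma convex_front_second_deriv_nonneg:
  assumes "convex_front D f" "is_interval D"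
    and der: "\<And>y. y \<in> D \<Longrightarrow> (f has_real_derivative f' y) (at y within D)"
    and der': "(f' has_real_derivative l) (at a within D)"
    and "a \<in> D" "b \<in> D" "a \<noteq> b"
  shows "0 \<le> l"
proof (rule ccontr)
  assume "\<not> 0 \<le> l"
  then have "l < 0" by simp
  have mono: "f' u \<le> f' v" if "u \<in> D" "v \<in> D" "u < v" for u v
  proof -
    have "f' u * (v - u) \<le> f v - f u" "f' v * (u - v) \<le> f u - f v"
      using convex_front_tangent assms(1,2) der that by blast+
    then have "f' u * (v - u) \<le> f' v * (v - u)"
      by (simp add: algebra_simps)
    then show ?thesis
      using that by simp
  qed
  have between: "c \<in> D" if "u \<in> D" "v \<in> D" "u \<le> c" "c \<le> v" for u v c
    using assms(2) that unfolding is_interval_1 by blast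
  show False
  \<comment> \<open>As \<open>a\<close> may be an end point of \<open>D\<close>, the comparison
    point is sought on the side where \<open>b\<close> lies; the minimum in \<open>h\<close> keeps
    it between \<open>a\<close> and \<open>b\<close>.\<close>
  proof (cases "a < b")
    case True
    obtain d where d: "d > 0" "\<And>h. h > 0 \<Longrightarrow> a + h \<in> D \<Longrightarrow> h < d \<Longrightarrow> f' (a + h) < f' a"
      using has_real_derivative_neg_dec_right[OF der' \<open>l < 0\<close>] by auto
    define h where "h = min (d / 2) (b - a)"
    have h: "h > 0" "h < d" "a + h \<le> b"
      using d(1) True by (auto simp: h_def min_def)
    then have "a + h \<in> D"
      using between[of a b] assms(5,6) by auto
    then show False
      using d(2)[of h] mono[of a "a + h"] h assms(5) by auto
  next
    case False
    then have "b < a"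
      using \<open>a \<noteq> b\<close> by simp
    obtain d where d: "d > 0" "\<And>h. h > 0 \<Longrightarrow> a - h \<in> D \<Longrightarrow> h < d \<Longrightarrow> f' a < f' (a - h)"
      using has_real_derivative_neg_dec_left[OF der' \<open>l < 0\<close>] by auto
    define h where "h = min (d / 2) (a - b)"
    have h: "h > 0" "h < d" "b \<le> a - h"
      using d(1) \<open>b < a\<close> by (auto simp: h_def min_def)
    then have "a - h \<in> D"
      using between[of b a] assms(5,6) by auto
    then show False
      using d(2)[of h] mono[of "a - h" a] h assms(5) by auto
  qed
qed

text \<open>By the mean value theorem the graph lies above all its tangents. At a point of a chord,
  the weighted mean of the two tangent inequalities is the convexity inequality.\<close>

lemma convex_front_if_deriv_mono:
  assumes "is_interval D"
    and der: "\<And>y. y \<in> D \<Longrightarrow> (f has_real_derivative f' y) (at y within D)"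
    and mono: "\<And>u v. u \<in> D \<Longrightarrow> v \<in> D \<Longrightarrow> u \<le> v \<Longrightarrow> f' u \<le> f' v"
  shows "convex_front D f"
proof -
  have tangent: "f' a * (b - a) \<le> f b - f a" if ab: "a \<in> D" "b \<in> D" for a b
  proof -
    have between: "c \<in> D" if "min a b \<le> c" "c \<le> max a b" for c
      using assms(1) ab that unfolding is_interval_1 by (metis max_def min_def)
    have sub: "{min a b..max a b} \<subseteq> D"
      using between by auto
    have "(f has_derivative (*) (f' c)) (at c within {min a b..max a b})"
      if "min a b \<le> c" "c \<le> max a b" for c
      using der[OF between[OF that]] sub unfolding has_field_derivative_def
      by (rule has_derivative_subset)
    moreover have "min a b \<le> max a b"
      by simp
    ultimately have "\<exists>c\<in>{min a b..max a b}. f (max a b) - f (min a b) = f' c * (max a b - min a b)"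
      by (intro mvt_very_simple) auto
    then obtain c where c: "c \<in> {min a b..max a b}"
        "f (max a b) - f (min a b) = f' c * (max a b - min a b)"
      by auto
    have eq: "f b - f a = f' c * (b - a)"
      using c by (cases "a \<le> b") (auto simp: min_def max_def algebra_simps)
    have "f' a * (b - a) \<le> f' c * (b - a)"
    proof (cases "a \<le> b")
      case True
      then show ?thesis
        using mono[of a c] between c ab by (intro mult_right_mono) auto
    next
      case False
      then show ?thesis
        using mono[of c a] between c ab by (intro mult_right_mono_neg) auto
    qed
    then show ?thesis
      using eq by simp
  qed
  show ?thesis
    unfolding convex_front_def
  proof (intro ballI impI)
    fix a b s :: real
    assume ab: "a \<in> D" "b \<in> D" and s: "s \<in> {0..1}"
    define c where "c = s * a + (1 - s) * b"
    assume "s * a + (1 - s) * b \<in> D"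
    then have c: "c \<in> D"
      by (simp add: c_def)
    \<comment> \<open>The slope terms cancel because \<open>c\<close> is the mean of
      \<open>a\<close> and \<open>b\<close> with weights \<open>s\<close> and
      \<open>1 - s\<close>.\<close>
    have "s * (f' c * (a - c)) + (1 - s) * (f' c * (b - c)) \<le> s * (f a - f c) + (1 - s) * (f b - f c)"
      using tangent[OF c] ab s by (intro add_mono mult_left_mono) auto
    moreover have "s * (f' c * (a - c)) + (1 - s) * (f' c * (b - c)) = 0"
      by (simp add: c_def algebra_simps)
    ultimately have "f c \<le> s * f a + (1 - s) * f b"
      by (simp add: algebra_simps)
    then show "f (s * a + (1 - s) * b) \<le> s * f a + (1 - s) * f b"
      by (simp add: c_def)
  qed
qed

section \<open>Fronts parametrized by a weight\<close>

text \<open>The derivative functions in the definition are merely some witnesses, taken within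
  \<open>I\<close>. On an open set they are two-sided and unique, so \<open>deriv f\<close> can
  replace the first one.\<close>

lemma twice_differentiable_on_open:
  assumes "twice_differentiable_on f I" "open I"
  shows "\<exists>f''. \<forall>y\<in>I. (f has_real_derivative deriv f y) (at y) \<and>
    (deriv f has_real_derivative f'' y) (at y)"
proof -
  obtain f' f'' where der: "\<And>y. y \<in> I \<Longrightarrow> (f has_real_derivative f' y) (at y)"
      "\<And>y. y \<in> I \<Longrightarrow> (f' has_real_derivative f'' y) (at y)"
    using assms unfolding twice_differentiable_on_def by (metis at_within_open)
  have eq: "f' y = deriv f y" if "y \<in> I" for y
    using der(1)[OF that] by (simp add: DERIV_imp_deriv)
  have "(deriv f has_real_derivative f'' y) (at y)" if "y \<in> I" for y
    using has_field_derivative_transform_within_open[OF der(2)[OF that] assms(2) that eq] .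
  then show ?thesis
    using der(1) eq by (intro exI[of _ f'']) simp
qed

lemma convex_front_iff_parametrization:
  fixes F1 F2 PF :: "real \<Rightarrow> real"
  assumes "open I" "connected I"
    and PF: "\<And>w. w \<in> I \<Longrightarrow> F2 w = PF (F1 w)"
    and F1: "twice_differentiable_on F1 I"
    and PF_diff: "twice_differentiable_on PF (F1 ` I)"
  shows "convex_front (F1 ` I) PF \<longleftrightarrow>
    (\<forall>w\<in>I. deriv F1 w * (deriv F1 w * deriv (deriv F2) w - deriv (deriv F1) w * deriv F2 w) \<ge> 0)"
proof -
  let ?D = "F1 ` I"
  obtain F1'' where F1_der: "\<And>w. w \<in> I \<Longrightarrow> (F1 has_real_derivative deriv F1 w) (at w)"
      "\<And>w. w \<in> I \<Longrightarrow> (deriv F1 has_real_derivative F1'' w) (at w)"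
    using twice_differentiable_on_open[OF F1 \<open>open I\<close>] by blast
  obtain p p' where PF_der: "\<And>y. y \<in> ?D \<Longrightarrow> (PF has_real_derivative p y) (at y within ?D)"
      "\<And>y. y \<in> ?D \<Longrightarrow> (p has_real_derivative p' y) (at y within ?D)"
    using PF_diff unfolding twice_differentiable_on_def by blast
  \<comment> \<open>The outer derivative is taken within \<open>?D\<close>, which may contain its
    end points or be a single point. Since \<open>F1\<close> maps \<open>I\<close> into
    \<open>?D\<close>, the composition is nevertheless differentiable in the two-sided sense on the
    open set \<open>I\<close>.\<close>
  have chain: "((\<lambda>w. q (F1 w)) has_real_derivative l * deriv F1 w) (at w)"
    if "w \<in> I" "(q has_real_derivative l) (at (F1 w) within ?D)" for q l w
  proof -
    have "(F1 has_real_derivative deriv F1 w) (at w within I)"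
      using F1_der(1)[OF that(1)] by (rule DERIV_subset) simp
    from DERIV_image_chain[OF that(2) this] show ?thesis
      using at_within_open[OF that(1) \<open>open I\<close>] by (simp add: o_def)
  qed
  have F2': "deriv F2 w = p (F1 w) * deriv F1 w" if "w \<in> I" for w
    using has_field_derivative_transform_within_open[OF chain[OF that PF_der(1)] \<open>open I\<close> that]
      PF that by (metis DERIV_imp_deriv imageI)
  have F2'': "deriv (deriv F2) w = p' (F1 w) * (deriv F1 w)\<^sup>2 + p (F1 w) * F1'' w" if "w \<in> I" for w
  proof (rule DERIV_imp_deriv, rule has_field_derivative_transform_within_open[OF _ \<open>open I\<close> that])
    show "((\<lambda>w. p (F1 w) * deriv F1 w) has_real_derivative
        p' (F1 w) * (deriv F1 w)\<^sup>2 + p (F1 w) * F1'' w) (at w)"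
      using chain[OF that PF_der(2)] F1_der(2)[OF that] that
      by (auto intro!: derivative_eq_intros simp: power2_eq_square)
  qed (simp add: F2')
  \<comment> \<open>The terms containing \<open>p\<close> cancel, so only the second derivative of
    \<open>PF\<close> remains.\<close>
  have expr: "deriv F1 w * (deriv F1 w * deriv (deriv F2) w - deriv (deriv F1) w * deriv F2 w) =
      p' (F1 w) * (deriv F1 w) ^ 4" if "w \<in> I" for w
    using F1_der(2)[OF that]
    by (simp add: F2'[OF that] F2''[OF that] DERIV_imp_deriv power2_eq_square power4_eq_xxxx algebra_simps)
  have iff_p': "0 \<le> deriv F1 w * (deriv F1 w * deriv (deriv F2) w - deriv (deriv F1) w * deriv F2 w)
      \<longleftrightarrow> deriv F1 w = 0 \<or> 0 \<le> p' (F1 w)" if "w \<in> I" for w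
    by (auto simp: expr[OF that] zero_le_mult_iff)
  have "continuous_on I F1"
    using F1_der(1) by (meson DERIV_isCont continuous_at_imp_continuous_on)
  then have interval: "is_interval ?D"
    using \<open>connected I\<close> by (simp add: connected_continuous_image is_interval_connected_1)
  show ?thesis
  proof
    assume convex: "convex_front ?D PF"
    have "0 \<le> p' (F1 w)" if w: "w \<in> I" "deriv F1 w \<noteq> 0" for w
    proof -
      \<comment> \<open>A constant \<open>F1\<close> would have derivative 0 at \<open>w\<close>.
        The value at \<open>z\<close> supplies the second point of \<open>?D\<close> needed to
        determine the sign of \<open>p'\<close>.\<close>
      have "\<exists>z\<in>I. F1 z \<noteq> F1 w"
      proof (rule ccontr)
        assume "\<not> ?thesis"
        then have "(F1 has_real_derivative 0) (at w)"
          using has_field_derivative_transform_within_open[OF DERIV_const \<open>open I\<close> w(1), of "F1 w" F1] by simp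
        then show False
          using w(2) DERIV_imp_deriv by blast
      qed
      then show ?thesis
        using convex_front_second_deriv_nonneg[OF convex interval PF_der(1) PF_der(2)] w by force
    qed
    then show "\<forall>w\<in>I. 0 \<le> deriv F1 w * (deriv F1 w * deriv (deriv F2) w - deriv (deriv F1) w * deriv F2 w)"
      by (auto simp: iff_p')
  next
    assume "\<forall>w\<in>I. 0 \<le> deriv F1 w * (deriv F1 w * deriv (deriv F2) w - deriv (deriv F1) w * deriv F2 w)"
    then have nonneg: "deriv F1 w = 0 \<or> 0 \<le> p' (F1 w)" if "w \<in> I" for w
      using iff_p' that by blast
    define C where "C = {w \<in> I. deriv F1 w = 0}"
    have "negligible (F1 ` C)"
    proof (rule negligible_critical_values)
      show "(F1 has_real_derivative 0) (at w within C)" if "w \<in> C" for w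
        using F1_der(1)[of w] that by (auto simp: C_def intro: DERIV_subset)
    qed
    \<comment> \<open>Any preimage of such a \<open>y\<close> is a regular point, where the
      condition forces the sign of \<open>p'\<close>.\<close>
    moreover have "0 \<le> p' y" if "y \<in> ?D - F1 ` C" for y
      using nonneg that by (auto simp: C_def)
    ultimately have "p u \<le> p v" if uv: "u \<in> ?D" "v \<in> ?D" "u \<le> v" for u v
    proof -
      have sub: "{u..v} \<subseteq> ?D"
        using interval uv unfolding is_interval_1 by (meson atLeastAtMost_iff subsetI)
      show ?thesis
      proof (rule le_if_deriv_nonneg_ae[OF uv(3) \<open>negligible (F1 ` C)\<close>])
        show "(p has_real_derivative p' y) (at y within {u..v})" if "y \<in> {u..v}" for y
          using PF_der(2) sub that by (meson DERIV_subset subsetD)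
        show "0 \<le> p' y" if "y \<in> {u..v} - F1 ` C" for y
          using \<open>\<And>y. y \<in> ?D - F1 ` C \<Longrightarrow> 0 \<le> p' y\<close> sub that by blast
      qed
    qed
    then show "convex_front ?D PF"
      using convex_front_if_deriv_mono[OF interval PF_der(1)] by blast
  qed
qed

theorem theorem2:
  fixes A :: "('m::{t2_space, second_countable_topology}, 'e::real_normed_vector) chart set"
    and g :: "('m, 'e) metric"
    and \<Gamma> :: "('m, 'e) connection"
    and t0 tf :: real
    and x0 x1 :: 'm
    and v0 v1 :: "('m, 'e) tangent"
    and S :: scalarization
    and x :: "real \<Rightarrow> real \<Rightarrow> 'm"
    and F1 F2 PF :: "real \<Rightarrow> real"
  assumes "riemannian_manifold A g"
    and "path_connected (UNIV :: 'm set)"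
    and "levi_civita A g \<Gamma>"
    and "t0 < tf"
    and "v0 \<in> tangent_space A x0"
    and "v1 \<in> tangent_space A x1"
    and optimal: "\<And>w. w \<in> {0<..<1} \<Longrightarrow>
      is_arg_min (\<lambda>y. S w (objective1 A g t0 tf y) (objective2 A g \<Gamma> t0 tf y))
        (\<lambda>y. y \<in> admissible_curves A t0 tf x0 v0 x1 v1) (\<lambda>t. x t w)"
    and F1: "F1 = (\<lambda>w. objective1 A g t0 tf (\<lambda>t. x t w))"
    and F2: "F2 = (\<lambda>w. objective2 A g \<Gamma> t0 tf (\<lambda>t. x t w))"
    and PF: "\<And>w. w \<in> {0<..<1} \<Longrightarrow> F2 w = PF (F1 w)"
    and "twice_differentiable_on F1 {0<..<1}"
    and "twice_differentiable_on F2 {0<..<1}"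
    and "twice_differentiable_on PF (Domain (pareto_front F1 F2))"
  shows "convex_front (Domain (pareto_front F1 F2)) PF \<longleftrightarrow>
    (\<forall>w\<in>{0<..<1}. deriv F1 w * (deriv F1 w * deriv (deriv F2) w - deriv (deriv F1) w * deriv F2 w) \<ge> 0)"
proof -
  have D: "Domain (pareto_front F1 F2) = F1 ` {0<..<1}"
    by (force simp: pareto_front_def Domain_iff image_iff)
  show ?thesis
    using convex_front_iff_parametrization[of "{0<..<1}" F2 PF F1] assms(11,13) PF by (simp add: D)
qed

end
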